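(* The competitive ratio of the online simple unbounded knapsack problem is $2$. That is, there is a deterministic online algorithm whose (strict) competitive ratio is at most $2$, and for every deterministic online algorithm and every $c<2$ there is an instance on which its competitive ratio exceeds $c$.
   Context: Online simple unbounded knapsack problem: the knapsack has capacity $1$. An instance is a finite sequence of items $x_1,\dots,x_n$ (with $n$ unknown to the algorithm), item $x_i$ having a size $s_i\in[0,1]$ and a value $v_i=s_i$. Items arrive one by one; upon arrival of $x_i$ the algorithm must irrevocably decide a number $k_i\in\mathbb{N}_0$ of copies of $x_i$ to pack, subject to $\sum_i k_i s_i\le 1$ at all times. The gain $\mathrm{gain}_{\mathrm{ALG}}(I)$ is the total value packed, and $\mathrm{opt}(I)=\max\{\sum_i k_i v_i : k_i\in\mathbb{N}_0,\ \sum_i k_i s_i\le 1\}$. The (strict) competitive ratio of an algorithm on $I$ is $\mathrm{opt}(I)/\mathrm{gain}_{\mathrm{ALG}}(I)$ (infinite if the gain is $0$ and $\mathrm{opt}(I)>0$); the competitive ratio of the algorithm is the supremum over all instances, and the competitive ratio of the problem is the infimum over all algorithms. *)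

theory Defs
  imports Complex_Main "HOL-Library.Extended_Real" "HOL-Library.FuncSet"
begin

text \<open>
  In the simple problem the value of an item equals its size, so an item is given by its size
  and an instance by the list of its item sizes, in order of arrival.
\<close>

definition is_instance :: "real list \<Rightarrow> bool" where
  "is_instance I \<longleftrightarrow> (\<forall>s \<in> set I. 0 \<le> s \<and> s \<le> 1)"

text \<open>
  Here \<open>k i\<close> is the number of copies packed of item \<open>I ! i\<close> (indices from 0); only indices
  below the length of \<open>I\<close> matter. As values and sizes coincide, the total
  is both the total size and the total value of the packed copies.
\<close>

definition packed_total :: "real list \<Rightarrow> (nat \<Rightarrow> nat) \<Rightarrow> real" where
  "packed_total I k = (\<Sum>i<length I. real (k i) * I ! i)"

definition is_packing :: "real list \<Rightarrow> (nat \<Rightarrow> nat) \<Rightarrow> bool" where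
  "is_packing I k \<longleftrightarrow> packed_total I k \<le> 1"

definition opt :: "real list \<Rightarrow> real" where
  "opt I = Max {packed_total I k |k. is_packing I k}"

text \<open>
  The maximum exists: items of size 0 admit infinitely many packings, but do not affect the total.
\<close>

lemma finite_packed_totals:
  assumes "is_instance I"
  shows "finite {packed_total I k |k. is_packing I k}"
proof -
  define B where "B i = (if I ! i = 0 then 0 else nat \<lfloor>1 / I ! i\<rfloor>)" for i
  have nonneg: "0 \<le> I ! i" if "i < length I" for i
    using assms that by (simp add: is_instance_def)
  have "{packed_total I k |k. is_packing I k}
      \<subseteq> packed_total I ` (PiE {..<length I} (\<lambda>i. {..B i}))"
  proof safe
    fix k assume k: "is_packing I k"
    define k' where "k' = restrict (\<lambda>i. if I ! i = 0 then 0 else k i) {..<length I}"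
    have "k' i \<le> B i" if i: "i < length I" for i
    proof (cases "I ! i = 0")
      case False
      with nonneg[OF i] have pos: "0 < I ! i" by simp
      have "real (k i) * I ! i \<le> packed_total I k"
        unfolding packed_total_def
        by (rule member_le_sum) (use i nonneg in auto)
      with k have "real (k i) * I ! i \<le> 1" by (simp add: is_packing_def)
      with pos have "real (k i) \<le> 1 / I ! i" by (simp add: field_simps)
      then have "k i \<le> nat \<lfloor>1 / I ! i\<rfloor>" by (simp add: le_nat_floor)
      with i False show ?thesis by (simp add: k'_def B_def)
    qed (use i in \<open>simp add: k'_def\<close>)
    then have "k' \<in> PiE {..<length I} (\<lambda>i. {..B i})"
      by (auto simp: k'_def)
    moreover have "packed_total I k = packed_total I k'"
      unfolding packed_total_def by (rule sum.cong) (auto simp: k'_def)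
    ultimately show "packed_total I k \<in> packed_total I ` (PiE {..<length I} (\<lambda>i. {..B i}))"
      by blast
  qed
  then show ?thesis
    by (rule finite_subset) (intro finite_imageI finite_PiE, auto)
qed

text \<open>
  A deterministic algorithm maps the items seen so far, the current one last, to the number of
  copies of the current item. Its own earlier decisions are determined by the items seen, and the
  number of items still to come is not available to it.
\<close>

type_synonym algorithm = "real list \<Rightarrow> nat"

definition decisions :: "algorithm \<Rightarrow> real list \<Rightarrow> nat \<Rightarrow> nat" where
  "decisions A I i = A (take (Suc i) I)"

text \<open>
  Every prefix of an instance is an instance, so the capacity is respected at all times.
\<close>

definition online_algorithm :: "algorithm \<Rightarrow> bool" where
  "online_algorithm A \<longleftrightarrow> (\<forall>I. is_instance I \<longrightarrow> is_packing I (decisions A I))"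

definition gain :: "algorithm \<Rightarrow> real list \<Rightarrow> real" where
  "gain A I = packed_total I (decisions A I)"

text \<open>
  The indeterminate ratio 0/0 (only items of size 0, or no items) is set to 1.
\<close>

definition ratio_on :: "algorithm \<Rightarrow> real list \<Rightarrow> ereal" where
  "ratio_on A I =
    (if gain A I = 0 then (if opt I = 0 then 1 else \<infinity>) else ereal (opt I / gain A I))"

definition competitive_ratio :: "algorithm \<Rightarrow> ereal" where
  "competitive_ratio A = (SUP I \<in> {I. is_instance I}. ratio_on A I)"

definition problem_competitive_ratio :: ereal where
  "problem_competitive_ratio = (INF A \<in> {A. online_algorithm A}. competitive_ratio A)"

end

theory Submission
  imports Defs
begin

text \<open>
  Upper bound: pack as many copies as possible of the first item of positive size \<open>s\<close> and nothing
  else. Then \<open>\<lfloor>1 / s\<rfloor> * s\<close> is at least \<open>1 / 2\<close>, since it is \<open>s\<close> if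
  \<open>s > 1 / 2\<close> and otherwise exceeds \<open>1 - s\<close>.
  Lower bound: offer an item of size slightly above \<open>1 / 2\<close>. If it is rejected, the ratio is
  infinite; otherwise a second item of size exactly \<open>1 / 2\<close> no longer fits, while two copies of
  it would fill the knapsack.
\<close>

lemma packed_total_le_opt:
  assumes "is_instance I" "is_packing I k"
  shows "packed_total I k \<le> opt I"
  unfolding opt_def using assms by (intro Max_ge finite_packed_totals) auto

lemma opt_le_1:
  assumes "is_instance I"
  shows "opt I \<le> 1"
proof -
  \<comment> \<open>The empty packing makes the set of totals nonempty, which the characterisation
    of \<open>Max\<close> requires.\<close>
  have "packed_total I (\<lambda>_. 0) = 0"
    by (simp add: packed_total_def)
  then have "{packed_total I k |k. is_packing I k} \<noteq> {}"
    by (auto simp: is_packing_def intro!: exI[of _ "\<lambda>_. 0"])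
  then show ?thesis
    unfolding opt_def using finite_packed_totals[OF assms]
    by (subst Max_le_iff) (auto simp: is_packing_def)
qed

lemma packed_total_eq_0:
  assumes "\<forall>s \<in> set I. s = 0"
  shows "packed_total I k = 0"
  unfolding packed_total_def using assms by (intro sum.neutral) auto

lemma opt_eq_0:
  assumes "\<forall>s \<in> set I. s = 0"
  shows "opt I = 0"
proof -
  have "{packed_total I k |k. is_packing I k} = {0}"
    using packed_total_eq_0[OF assms] by (auto simp: is_packing_def)
  then show ?thesis
    by (simp add: opt_def)
qed

lemma floor_inverse_mult_bounds:
  fixes s :: real
  assumes "0 < s" "s \<le> 1"
  shows "real (nat \<lfloor>1 / s\<rfloor>) * s \<le> 1" "1 / 2 \<le> real (nat \<lfloor>1 / s\<rfloor>) * s"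
proof -
  define n where "n = nat \<lfloor>1 / s\<rfloor>"
  have floor: "real n = of_int \<lfloor>1 / s\<rfloor>" "1 \<le> \<lfloor>1 / s\<rfloor>"
    using assms by (simp_all add: n_def)
  then have "real n \<le> 1 / s" "1 / s < real n + 1" "1 \<le> real n"
    by linarith+
  \<comment> \<open>The last two facts give \<open>1 < 2 * (real n * s)\<close>, so no case split at
    \<open>s = 1 / 2\<close> is needed.\<close>
  then have "real n * s \<le> 1" "1 < real n * s + s" "s \<le> real n * s"
    using assms by (simp_all add: field_simps)
  then show "real (nat \<lfloor>1 / s\<rfloor>) * s \<le> 1" "1 / 2 \<le> real (nat \<lfloor>1 / s\<rfloor>) * s"
    unfolding n_def by linarith+
qed

text \<open>Earlier decisions are not part of the input, so whether something was packed is read off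
  from the earlier sizes. For a current item of size 0, division by zero yields 0 copies.\<close>

definition pack_first_positive :: algorithm where
  "pack_first_positive I =
    (if \<forall>s \<in> set (butlast I). s = 0 then nat \<lfloor>1 / last I\<rfloor> else 0)"

lemma decisions_pack_first_positive:
  assumes "i < length I"
  shows "decisions pack_first_positive I i =
    (if \<forall>m<i. I ! m = 0 then nat \<lfloor>1 / I ! i\<rfloor> else 0)"
proof -
  have "take (Suc i) I = take i I @ [I ! i]"
    using assms by (rule take_Suc_conv_app_nth)
  moreover have "set (take i I) = (\<lambda>m. I ! m) ` {..<i}"
    using assms by (simp add: nth_image atLeast0LessThan[symmetric])
  ultimately show ?thesis
    by (auto simp: decisions_def pack_first_positive_def)
qed

text \<open>Only the first positive item contributes, and \<open>s\<close> is its size. Both bounds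
  of \<open>floor_inverse_mult_bounds\<close> then apply: one gives feasibility, the other the
  ratio.\<close>

lemma gain_pack_first_positive:
  assumes "is_instance I" "\<exists>s \<in> set I. s \<noteq> 0"
  obtains s where "0 < s" "s \<le> 1" "gain pack_first_positive I = real (nat \<lfloor>1 / s\<rfloor>) * s"
proof -
  define j where "j = (LEAST i. i < length I \<and> I ! i \<noteq> 0)"
  have "\<exists>i. i < length I \<and> I ! i \<noteq> 0"
    using assms(2) by (auto simp: in_set_conv_nth)
  then have j: "j < length I" "I ! j \<noteq> 0"
    unfolding j_def by (metis (mono_tags, lifting) LeastI_ex)+
  have before: "I ! i = 0" if "i < j" for i
    using that j(1) not_less_Least[of i "\<lambda>i. i < length I \<and> I ! i \<noteq> 0"]
    unfolding j_def[symmetric] by auto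
  define f where "f i = real (decisions pack_first_positive I i) * I ! i" for i
  \<comment> \<open>Before \<open>j\<close> the size is 0; after \<open>j\<close> the number of
    copies is 0, because \<open>I ! j\<close> is an earlier nonzero item.\<close>
  have "f i = 0" if "i < length I" "i \<noteq> j" for i
    using that before j(2)
    by (cases "i < j") (auto simp: f_def decisions_pack_first_positive)
  then have "gain pack_first_positive I = sum f {j}"
    unfolding gain_def packed_total_def f_def[symmetric]
    using j(1) by (intro sum.mono_neutral_right) auto
  also have "\<dots> = real (nat \<lfloor>1 / I ! j\<rfloor>) * I ! j"
    using j(1) before by (simp add: f_def decisions_pack_first_positive)
  finally show ?thesis
    using that[of "I ! j"] assms(1) j by (simp add: is_instance_def less_le)
qed

lemma online_algorithm_pack_first_positive: "online_algorithm pack_first_positive"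
  unfolding online_algorithm_def
proof (intro allI impI)
  fix I
  assume I: "is_instance I"
  have "gain pack_first_positive I \<le> 1"
  proof (cases "\<forall>s \<in> set I. s = 0")
    case True
    then show ?thesis by (simp add: gain_def packed_total_eq_0)
  next
    case False
    then show ?thesis
      using gain_pack_first_positive[OF I] floor_inverse_mult_bounds(1) by metis
  qed
  then show "is_packing I (decisions pack_first_positive I)"
    by (simp add: is_packing_def gain_def)
qed

lemma ratio_on_pack_first_positive_le_2:
  assumes "is_instance I"
  shows "ratio_on pack_first_positive I \<le> 2"
proof (cases "\<forall>s \<in> set I. s = 0")
  case True
  then have "gain pack_first_positive I = 0"
    by (simp add: gain_def packed_total_eq_0)
  \<comment> \<open>Here the convention for 0/0 makes the ratio 1.\<close>
  then show ?thesis
    using opt_eq_0[OF True] by (simp add: ratio_on_def)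
next
  case False
  then have "1 / 2 \<le> gain pack_first_positive I"
    using gain_pack_first_positive[OF assms] floor_inverse_mult_bounds(2) by metis
  then show ?thesis
    using opt_le_1[OF assms] by (simp add: ratio_on_def field_simps)
qed

lemma ratio_on_gt:
  assumes A: "online_algorithm A" and c: "c < (2::real)"
  shows "\<exists>I. is_instance I \<and> ratio_on A I > ereal c"
proof -
  \<comment> \<open>As \<open>c\<close> may be small or negative, it is raised to at least 1; then
    \<open>1 / c'\<close> lies in (1/2, 1] and bounds an admissible size.\<close>
  define c' where "c' = max c 1"
  have c': "1 \<le> c'" "c' < 2" "c \<le> c'"
    using c by (auto simp: c'_def)
  then have "1 / 2 < 1 / c'"
    by (simp add: field_simps)
  then obtain s where s: "1 / 2 < s" "s < 1 / c'"
    using dense by blast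
  have "1 / c' \<le> 1"
    using c' by simp
  with s have s1: "s < 1"
    by linarith
  have "c' < 1 / s"
    using s c' by (simp add: field_simps)
  then have c_less: "c < 1 / s"
    using c' by linarith
  have I1: "is_instance [s]" and I2: "is_instance [s, 1 / 2]"
    using s s1 by (auto simp: is_instance_def)
  show ?thesis
  \<comment> \<open>The first decision is \<open>A [s]\<close> on both instances, since the
    algorithm cannot see whether a second item follows.\<close>
  proof (cases "A [s] = 0")
    case True
    then have "gain A [s] = 0"
      by (simp add: gain_def packed_total_def decisions_def)
    moreover have "s \<le> opt [s]"
      using packed_total_le_opt[OF I1, of "\<lambda>_. 1"] s1
      by (simp add: is_packing_def packed_total_def)
    ultimately have "ratio_on A [s] = \<infinity>"
      using s by (simp add: ratio_on_def)
    then show ?thesis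
      using I1 by auto
  next
    case False
    have "is_packing [s, 1 / 2] (decisions A [s, 1 / 2])"
      using A I2 by (simp add: online_algorithm_def)
    then have cap: "real (A [s]) * s + real (A [s, 1 / 2]) / 2 \<le> 1"
      by (simp add: is_packing_def packed_total_def decisions_def)
    have "s \<le> real (A [s]) * s"
      using False s by simp
    with cap s have "A [s, 1 / 2] = 0"
      by linarith
    moreover have "A [s] = 1"
    \<comment> \<open>Two or more copies of \<open>s\<close> would exceed the capacity because
      \<open>s > 1 / 2\<close>.\<close>
    proof (rule ccontr)
      assume "A [s] \<noteq> 1"
      with False have "2 * s \<le> real (A [s]) * s"
        using s by (intro mult_right_mono) auto
      with cap s show False by linarith
    qed
    ultimately have gain: "gain A [s, 1 / 2] = s"
      by (simp add: gain_def packed_total_def decisions_def)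
    have "1 \<le> opt [s, 1 / 2]"
      using packed_total_le_opt[OF I2, of "\<lambda>i. if i = 1 then 2 else 0"]
      by (simp add: is_packing_def packed_total_def)
    then have "1 / s \<le> opt [s, 1 / 2] / s"
      using s by (simp add: divide_right_mono)
    then have "ereal c < ratio_on A [s, 1 / 2]"
      using s c_less gain by (simp add: ratio_on_def)
    then show ?thesis
      using I2 by blast
  qed
qed

theorem theorem1:
  "problem_competitive_ratio = 2
   \<and> (\<exists>A. online_algorithm A \<and> competitive_ratio A \<le> 2)
   \<and> (\<forall>A (c::real). online_algorithm A \<and> c < 2
        \<longrightarrow> (\<exists>I. is_instance I \<and> ratio_on A I > ereal c))"
proof -
  have upper: "competitive_ratio pack_first_positive \<le> 2"
    unfolding competitive_ratio_def
    by (rule SUP_least) (use ratio_on_pack_first_positive_le_2 in blast)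
  have lower: "2 \<le> competitive_ratio A" if A: "online_algorithm A" for A
  proof (rule ccontr)
    assume "\<not> 2 \<le> competitive_ratio A"
    \<comment> \<open>The adversary bound is stated for real \<open>c\<close>, so a real number
      strictly between the extended real ratio and 2 is chosen.\<close>
    then obtain c :: real where c: "competitive_ratio A < ereal c" "ereal c < 2"
      using ereal_dense2[of "competitive_ratio A" 2] by (metis not_le)
    then have "c < 2"
      by simp
    then obtain I where I: "is_instance I" "ereal c < ratio_on A I"
      using ratio_on_gt[OF A] by blast
    have "ratio_on A I \<le> competitive_ratio A"
      unfolding competitive_ratio_def using I(1) by (intro SUP_upper) simp
    with I(2) c(1) show False
      by simp
  qed
  have "problem_competitive_ratio = 2"
  proof (rule antisym)
    show "problem_competitive_ratio \<le> 2"
      unfolding problem_competitive_ratio_def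
      using online_algorithm_pack_first_positive upper by (intro INF_lower2) auto
    show "2 \<le> problem_competitive_ratio"
      unfolding problem_competitive_ratio_def by (rule INF_greatest) (use lower in blast)
  qed
  then show ?thesis
    using upper online_algorithm_pack_first_positive ratio_on_gt by blast
qed

end
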